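(* Let $H$ be an atomic cancellative small category. The following statements are equivalent. (1) $H$ is permutably factorial. (2) $\mathsf t_p(H)=0$ and every almost prime-like element of $H$ is prime-like. (3) $\mathsf t_p(H,\mathsf Z_p(H))=0$ and every almost prime-like element of $H$ is prime-like.
   Context: A small category $H$ is identified with its set of morphisms (elements), with source $s(a)$ and target $t(a)$; $ab$ is defined iff $t(a)=s(b)$. $H^\times$ is the set of isomorphisms (units); $H$ is cancellative if $ab=ac$ or $ba=ca$ implies $b=c$. $a\simeq b$ (associated) if $b=\varepsilon a\eta$ with units $\varepsilon,\eta$. An atom is a non-unit $u$ such that $u=ab$ implies $a$ or $b$ is a unit; $\mathcal A(H)$ is the set of atoms; $H$ is atomic if every non-unit is a finite product of atoms. **Permutable factorizations.** Consider tuples $(\varepsilon;u_1,\dots,u_k)$, $k\ge0$, $\varepsilon\in H^\times$, $u_i\in\mathcal A(H)$ with $\varepsilon u_1\cdots u_k$ defined; the latter product is denoted $\pi$. Put $\mathsf d_p((\varepsilon;u_1,\dots,u_k),(\eta;v_1,\dots,v_l))=\max\{k,l\}-n$, where $n$ is the largest cardinality of $I\subset[1,k]$ admitting an injection $\sigma:I\to[1,l]$ with $u_i\simeq v_{\sigma(i)}$ on $I$. Two tuples are identified if they have the same product $\pi$ and $\mathsf d_p=0$ between them; the classes, written $[\varepsilon*u_1*\cdots*u_k]_p$, are the permutable factorizations and form the set $\mathsf Z_p(H)$; $\mathsf Z_p(a)$ is the set of those with product $a$. $\mathsf d_p$ is well defined on $\mathsf Z_p(H)$, and $\mathcal A(H)\subset\mathsf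 Z_p(H)$ via $u\mapsto[u]_p$. For $x=[\varepsilon*w_1*\cdots*w_m]_p$ and $z=[\eta*u_1*\cdots*u_k]_p$ write $x\mid_p z$ if there is an injective map $\sigma:[1,m]\to[1,k]$ with $w_i\simeq u_{\sigma(i)}$ for all $i$. $H$ is permutably factorial if $|\mathsf Z_p(a)|=1$ for all $a\in H$. **Tame degree.** For $a\in H$ and $x\in\mathsf Z_p(H)$, $\mathsf t_p(a,x)$ is the smallest $N\in\mathbb N_0\cup\{\infty\}$ such that: if there exists $z_0\in\mathsf Z_p(a)$ with $x\mid_p z_0$, then for every $z\in\mathsf Z_p(a)$ there is $z'\in\mathsf Z_p(a)$ with $x\mid_p z'$ and $\mathsf d_p(z,z')\le N$. For $H'\subset H$, $Z\subset\mathsf Z_p(H)$, $\mathsf t_p(H',Z)=\sup\{\mathsf t_p(a,z):a\in H',z\in Z\}$, and $\mathsf t_p(H)=\mathsf t_p(H,\mathcal A(H))$; $\sup\emptyset=0$. **Prime-like elements.** For $a,b\in H$ write $a\mid_p b$ if there are $x\in\mathsf Z_p(a)$, $z\in\mathsf Z_p(b)$ with $x\mid_p z$. A non-unit $q\in H$ is almost prime-like if $q\mid_p ab$ (with $t(a)=s(b)$) implies $q\mid_p a$ or $q\mid_p b$; in atomic $H$ such $q$ is an atom. $\mathsf V_q(a)\subset\mathbb N_0$ is the set of $n$ such that there are $k\in\mathbb N_0$ and atoms $u_1,\dots,u_k$ with $a\simeq u_1\cdots u_k$ and $n=|\{i:u_i\simeq q\}|$. An almost prime-like $q$ is prime-like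 if $|\mathsf V_q(a)|=1$ for all $a\in H$. *)

theory Defs
  imports Main "HOL-Library.Extended_Nat"
begin

section \<open>Small categories\<close>

text \<open>Composition is written in diagrammatic order: the product \<open>a \<cdot> b\<close> is defined iff
  \<open>tgt a = src b\<close>. The field \<open>mcomp\<close> is a total function whose values on non-composable pairs are
  irrelevant; every definition below guards its use by composability.\<close>

record ('o, 'm) cat =
  Ob :: "'o set"
  Mor :: "'m set"
  src :: "'m \<Rightarrow> 'o"
  tgt :: "'m \<Rightarrow> 'o"
  ident :: "'o \<Rightarrow> 'm"
  mcomp :: "'m \<Rightarrow> 'm \<Rightarrow> 'm" (infixl "\<cdot>\<index>" 70)

locale small_category =
  fixes H :: "('o, 'm) cat" (structure)
  assumes src_closed: "a \<in> Mor H \<Longrightarrow> src H a \<in> Ob H"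
    and tgt_closed: "a \<in> Mor H \<Longrightarrow> tgt H a \<in> Ob H"
    and ident_closed: "e \<in> Ob H \<Longrightarrow> ident H e \<in> Mor H"
    and src_ident: "e \<in> Ob H \<Longrightarrow> src H (ident H e) = e"
    and tgt_ident: "e \<in> Ob H \<Longrightarrow> tgt H (ident H e) = e"
    and comp_closed: "\<lbrakk>a \<in> Mor H; b \<in> Mor H; tgt H a = src H b\<rbrakk> \<Longrightarrow> a \<cdot> b \<in> Mor H"
    and src_comp: "\<lbrakk>a \<in> Mor H; b \<in> Mor H; tgt H a = src H b\<rbrakk> \<Longrightarrow> src H (a \<cdot> b) = src H a"
    and tgt_comp: "\<lbrakk>a \<in> Mor H; b \<in> Mor H; tgt H a = src H b\<rbrakk> \<Longrightarrow> tgt H (a \<cdot> b) = tgt H b"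
    and ident_left: "a \<in> Mor H \<Longrightarrow> ident H (src H a) \<cdot> a = a"
    and ident_right: "a \<in> Mor H \<Longrightarrow> a \<cdot> ident H (tgt H a) = a"
    and comp_assoc: "\<lbrakk>a \<in> Mor H; b \<in> Mor H; c \<in> Mor H; tgt H a = src H b; tgt H b = src H c\<rbrakk>
      \<Longrightarrow> (a \<cdot> b) \<cdot> c = a \<cdot> (b \<cdot> c)"

definition units :: "('o, 'm) cat \<Rightarrow> 'm set" where
  "units H = {a \<in> Mor H. \<exists>b \<in> Mor H. src H b = tgt H a \<and> tgt H b = src H a
     \<and> a \<cdot>\<^bsub>H\<^esub> b = ident H (src H a) \<and> b \<cdot>\<^bsub>H\<^esub> a = ident H (tgt H a)}"

definition cancellative :: "('o, 'm) cat \<Rightarrow> bool" where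
  "cancellative H \<longleftrightarrow>
     (\<forall>a \<in> Mor H. \<forall>b \<in> Mor H. \<forall>c \<in> Mor H.
        tgt H a = src H b \<and> tgt H a = src H c \<and> a \<cdot>\<^bsub>H\<^esub> b = a \<cdot>\<^bsub>H\<^esub> c \<longrightarrow> b = c) \<and>
     (\<forall>a \<in> Mor H. \<forall>b \<in> Mor H. \<forall>c \<in> Mor H.
        tgt H b = src H a \<and> tgt H c = src H a \<and> b \<cdot>\<^bsub>H\<^esub> a = c \<cdot>\<^bsub>H\<^esub> a \<longrightarrow> b = c)"

definition associated :: "('o, 'm) cat \<Rightarrow> 'm \<Rightarrow> 'm \<Rightarrow> bool" where
  "associated H a b \<longleftrightarrow> a \<in> Mor H \<and> b \<in> Mor H \<and>
     (\<exists>\<epsilon> \<in> units H. \<exists>\<eta> \<in> units H. tgt H \<epsilon> = src H a \<and> tgt H a = src H \<eta>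
        \<and> b = \<epsilon> \<cdot>\<^bsub>H\<^esub> a \<cdot>\<^bsub>H\<^esub> \<eta>)"

definition atoms :: "('o, 'm) cat \<Rightarrow> 'm set" where
  "atoms H = {u \<in> Mor H. u \<notin> units H \<and>
     (\<forall>a \<in> Mor H. \<forall>b \<in> Mor H. tgt H a = src H b \<and> u = a \<cdot>\<^bsub>H\<^esub> b
        \<longrightarrow> a \<in> units H \<or> b \<in> units H)}"

text \<open>\<open>path H e us\<close>: the morphisms \<open>us\<close> are successively composable, starting at the object \<open>e\<close>.\<close>

fun path :: "('o, 'm) cat \<Rightarrow> 'o \<Rightarrow> 'm list \<Rightarrow> bool" where
  "path H e [] \<longleftrightarrow> True"
| "path H e (u # us) \<longleftrightarrow> src H u = e \<and> path H (tgt H u) us"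

definition prod_from :: "('o, 'm) cat \<Rightarrow> 'm \<Rightarrow> 'm list \<Rightarrow> 'm" where
  "prod_from H a us = foldl (mcomp H) a us"

text \<open>\<open>is_prod H us a\<close>: \<open>a\<close> is the product of the list \<open>us\<close>. The empty product is an
  identity, at an arbitrary object; for nonempty \<open>us\<close> the object \<open>e\<close> is the source of the first
  entry, so that the product is the usual one.\<close>

definition is_prod :: "('o, 'm) cat \<Rightarrow> 'm list \<Rightarrow> 'm \<Rightarrow> bool" where
  "is_prod H us a \<longleftrightarrow> (\<exists>e \<in> Ob H. path H e us \<and> a = prod_from H (ident H e) us)"

definition atomic :: "('o, 'm) cat \<Rightarrow> bool" where
  "atomic H \<longleftrightarrow> (\<forall>a \<in> Mor H. a \<notin> units H \<longrightarrow> (\<exists>us. set us \<subseteq> atoms H \<and> is_prod H us a))"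


section \<open>Permutable factorizations\<close>

type_synonym 'm tuple = "'m \<times> 'm list"

definition tuples :: "('o, 'm) cat \<Rightarrow> 'm tuple set" where
  "tuples H = {(\<epsilon>, us). \<epsilon> \<in> units H \<and> set us \<subseteq> atoms H \<and> path H (tgt H \<epsilon>) us}"

definition tuple_prod :: "('o, 'm) cat \<Rightarrow> 'm tuple \<Rightarrow> 'm" where
  "tuple_prod H f = prod_from H (fst f) (snd f)"

text \<open>Positions in a list of length \<open>k\<close> are numbered \<open>0, \<dots>, k - 1\<close>.\<close>

definition matching :: "('o, 'm) cat \<Rightarrow> 'm list \<Rightarrow> 'm list \<Rightarrow> nat set \<Rightarrow> (nat \<Rightarrow> nat) \<Rightarrow> bool" where
  "matching H us vs I \<sigma> \<longleftrightarrow> I \<subseteq> {..<length us} \<and> inj_on \<sigma> I \<and> \<sigma> ` I \<subseteq> {..<length vs} \<and>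
     (\<forall>i \<in> I. associated H (us ! i) (vs ! \<sigma> i))"

definition tuple_dist :: "('o, 'm) cat \<Rightarrow> 'm tuple \<Rightarrow> 'm tuple \<Rightarrow> nat" where
  "tuple_dist H f g = max (length (snd f)) (length (snd g))
     - Max {card I | I. \<exists>\<sigma>. matching H (snd f) (snd g) I \<sigma>}"

definition tuple_rel :: "('o, 'm) cat \<Rightarrow> ('m tuple \<times> 'm tuple) set" where
  "tuple_rel H = {(f, g). f \<in> tuples H \<and> g \<in> tuples H \<and>
     tuple_prod H f = tuple_prod H g \<and> tuple_dist H f g = 0}"

definition Zp :: "('o, 'm) cat \<Rightarrow> 'm tuple set set" where
  "Zp H = tuples H // tuple_rel H"

definition Zp_of :: "('o, 'm) cat \<Rightarrow> 'm \<Rightarrow> 'm tuple set set" where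
  "Zp_of H a = {z \<in> Zp H. \<exists>f \<in> z. tuple_prod H f = a}"

text \<open>Both the distance and \<open>x \<bar>\<^sub>p z\<close> are independent of the chosen representatives.\<close>

definition dp :: "('o, 'm) cat \<Rightarrow> 'm tuple set \<Rightarrow> 'm tuple set \<Rightarrow> nat" where
  "dp H x z = (THE n. \<exists>f \<in> x. \<exists>g \<in> z. n = tuple_dist H f g)"

definition fact_dvd :: "('o, 'm) cat \<Rightarrow> 'm tuple set \<Rightarrow> 'm tuple set \<Rightarrow> bool" where
  "fact_dvd H x z \<longleftrightarrow>
     (\<exists>f \<in> x. \<exists>g \<in> z. \<exists>\<sigma>. matching H (snd f) (snd g) {..<length (snd f)} \<sigma>)"

definition atom_fact :: "('o, 'm) cat \<Rightarrow> 'm \<Rightarrow> 'm tuple set" where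
  "atom_fact H u = tuple_rel H `` {(ident H (src H u), [u])}"

definition permutably_factorial :: "('o, 'm) cat \<Rightarrow> bool" where
  "permutably_factorial H \<longleftrightarrow> (\<forall>a \<in> Mor H. card (Zp_of H a) = 1)"


section \<open>Tame degree\<close>

text \<open>The least element exists, since \<open>\<infinity>\<close> always satisfies the condition.\<close>

definition tame_at :: "('o, 'm) cat \<Rightarrow> 'm \<Rightarrow> 'm tuple set \<Rightarrow> enat" where
  "tame_at H a x = (LEAST N::enat. (\<exists>z0 \<in> Zp_of H a. fact_dvd H x z0) \<longrightarrow>
     (\<forall>z \<in> Zp_of H a. \<exists>z' \<in> Zp_of H a. fact_dvd H x z' \<and> enat (dp H z z') \<le> N))"

definition tame :: "('o, 'm) cat \<Rightarrow> 'm set \<Rightarrow> 'm tuple set set \<Rightarrow> enat" where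
  "tame H A Z = Sup {tame_at H a z | a z. a \<in> A \<and> z \<in> Z}"

definition tame_degree :: "('o, 'm) cat \<Rightarrow> enat" where
  "tame_degree H = tame H (Mor H) (atom_fact H ` atoms H)"


section \<open>Prime-like elements\<close>

definition perm_dvd :: "('o, 'm) cat \<Rightarrow> 'm \<Rightarrow> 'm \<Rightarrow> bool" where
  "perm_dvd H a b \<longleftrightarrow> (\<exists>x \<in> Zp_of H a. \<exists>z \<in> Zp_of H b. fact_dvd H x z)"

definition almost_prime_like :: "('o, 'm) cat \<Rightarrow> 'm \<Rightarrow> bool" where
  "almost_prime_like H q \<longleftrightarrow> q \<in> Mor H \<and> q \<notin> units H \<and>
     (\<forall>a \<in> Mor H. \<forall>b \<in> Mor H. tgt H a = src H b \<and> perm_dvd H q (a \<cdot>\<^bsub>H\<^esub> b)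
        \<longrightarrow> perm_dvd H q a \<or> perm_dvd H q b)"

definition V_set :: "('o, 'm) cat \<Rightarrow> 'm \<Rightarrow> 'm \<Rightarrow> nat set" where
  "V_set H q a = {n. \<exists>us p. set us \<subseteq> atoms H \<and> is_prod H us p \<and> associated H a p \<and>
     n = card {i. i < length us \<and> associated H (us ! i) q}}"

definition prime_like :: "('o, 'm) cat \<Rightarrow> 'm \<Rightarrow> bool" where
  "prime_like H q \<longleftrightarrow> almost_prime_like H q \<and> (\<forall>a \<in> Mor H. card (V_set H q a) = 1)"

end

theory Submission
  imports Defs "HOL-Library.Multiset"
begin

text \<open>Send a factorization to the multiset of association classes of its atoms. A permutable
  factorization is determined by its product and this multiset, \<open>x \<bar>\<^sub>p z\<close> becomes the
  submultiset relation, and \<open>d\<^sub>p = 0\<close> becomes equality of multisets.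
  If the tame degree vanishes, then an atom dividing one factorization of \<open>a\<close> divides all of them.
  Since the multisets of \<open>a\<close> and \<open>b\<close> add up to one of \<open>a b\<close>, every atom is then almost prime-like,
  hence prime-like, so all its multiplicities are determined by the product.
  Conversely, if every product has only one multiset, divisibility and multiplicities do not depend
  on the factorization.\<close>

section \<open>Matchings and multisets\<close>

text \<open>Passing to classes makes association an equality, so that factorizations can be compared
  as multisets. Outside \<open>Mor H\<close> the value is empty.\<close>

definition assoc_class :: "('o, 'm) cat \<Rightarrow> 'm \<Rightarrow> 'm set" where
  "assoc_class H u = {v. associated H u v}"

definition factor_mset :: "('o, 'm) cat \<Rightarrow> 'm list \<Rightarrow> 'm set multiset" where
  "factor_mset H us = image_mset (assoc_class H) (mset us)"

text \<open>Stands in for \<open>Zp_of H a\<close>: the unit and the order of the atoms are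
  forgotten, and \<open>fact_class\<close> below puts these multisets in bijection with the
  permutable factorizations of \<open>a\<close>.\<close>

definition factor_msets :: "('o, 'm) cat \<Rightarrow> 'm \<Rightarrow> 'm set multiset set" where
  "factor_msets H a = {factor_mset H us | \<epsilon> us. (\<epsilon>, us) \<in> tuples H \<and> prod_from H \<epsilon> us = a}"

lemma size_factor_mset [simp]: "size (factor_mset H us) = length us"
  by (simp add: factor_mset_def)

lemma factor_mset_Nil [simp]: "factor_mset H [] = {#}"
  and factor_mset_Cons [simp]: "factor_mset H (u # us) = add_mset (assoc_class H u) (factor_mset H us)"
  and factor_mset_append [simp]: "factor_mset H (us @ vs) = factor_mset H us + factor_mset H vs"
  by (simp_all add: factor_mset_def)

lemma mset_as_image_lessThan: "mset xs = image_mset ((!) xs) (mset_set {..<length xs})"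
  by (metis map_nth mset_map mset_upt atLeast0LessThan)

text \<open>Indexed form, since a matching is given by positions and not by entries.\<close>

lemma factor_mset_nth:
  "factor_mset H us = image_mset (\<lambda>i. assoc_class H (us ! i)) (mset_set {..<length us})"
  unfolding factor_mset_def by (subst mset_as_image_lessThan) (simp add: multiset.map_comp o_def)

lemma image_mset_subset_factor_mset:
  "I \<subseteq> {..<length us} \<Longrightarrow>
     image_mset (\<lambda>i. assoc_class H (us ! i)) (mset_set I) \<subseteq># factor_mset H us"
  unfolding factor_mset_nth
  by (intro image_mset_subseteq_mono subset_imp_msubset_mset_set) auto

text \<open>Splitting the positions into \<open>I\<close> and its complement and cancelling the
  share of \<open>I\<close> leaves \<open>x\<close> to be found in the complement. This is what
  allows a matching to be extended by one position.\<close>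

lemma ex_unused_index:
  assumes "I \<subseteq> {..<length us}"
    and "add_mset x (image_mset (\<lambda>i. assoc_class H (us ! i)) (mset_set I)) \<subseteq># factor_mset H us"
  obtains i where "i < length us" "i \<notin> I" "assoc_class H (us ! i) = x"
proof -
  let ?f = "\<lambda>i. assoc_class H (us ! i)"
  have "mset_set {..<length us} = mset_set I + mset_set ({..<length us} - I)"
    using assms(1) by (subst mset_set_Union [symmetric]) (auto intro: finite_subset simp: Un_absorb1)
  then have "add_mset x (image_mset ?f (mset_set I))
      \<subseteq># image_mset ?f (mset_set I) + image_mset ?f (mset_set ({..<length us} - I))"
    using assms(2) by (simp add: factor_mset_nth)
  then have "{#x#} \<subseteq># image_mset ?f (mset_set ({..<length us} - I))"
    by (metis add_mset_add_single subset_mset.add_le_cancel_left)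
  then have "x \<in> ?f ` ({..<length us} - I)"
    by simp
  then show ?thesis
    using that by auto
qed

text \<open>Subtraction is truncated, so a zero difference says that the intersection is at least as
  large as \<open>A\<close> and as \<open>B\<close>, hence equal to both. The left side is the shape
  that the distance of two factorizations takes below.\<close>

lemma max_size_diff_inter_eq_0_iff:
  "max (size A) (size B) - size (A \<inter># B) = 0 \<longleftrightarrow> A = B"
proof
  assume "max (size A) (size B) - size (A \<inter># B) = 0"
  then have "size A \<le> size (A \<inter># B)" "size B \<le> size (A \<inter># B)"
    by auto
  then have "A \<inter># B = A" "A \<inter># B = B"
    by (metis linorder_not_le mset_subset_size subset_mset.inf_le1
        subset_mset.inf_le2 subset_mset.le_neq_trans)+
  then show "A = B"
    by simp
qed simp

context small_category
begin

section \<open>Units, association and atoms\<close>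

lemma units_Mor: "a \<in> units H \<Longrightarrow> a \<in> Mor H"
  by (simp add: units_def)

lemma atoms_Mor: "a \<in> atoms H \<Longrightarrow> a \<in> Mor H"
  by (simp add: atoms_def)

lemma ident_units: "e \<in> Ob H \<Longrightarrow> ident H e \<in> units H"
  using ident_left[of "ident H e"]
  by (auto simp: units_def ident_closed src_ident tgt_ident intro!: bexI[of _ "ident H e"])

lemma units_inverse:
  assumes "a \<in> units H"
  obtains b where "b \<in> units H" "src H b = tgt H a" "tgt H b = src H a"
    "a \<cdot> b = ident H (src H a)" "b \<cdot> a = ident H (tgt H a)"
  using assms by (fastforce simp: units_def)

lemma units_comp:
  assumes "a \<in> units H" "b \<in> units H" "tgt H a = src H b"
  shows "a \<cdot> b \<in> units H"
proof -
  obtain c where c: "c \<in> units H" "src H c = tgt H a" "tgt H c = src H a"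
    "a \<cdot> c = ident H (src H a)" "c \<cdot> a = ident H (tgt H a)"
    using assms(1) by (rule units_inverse)
  obtain d where d: "d \<in> units H" "src H d = tgt H b" "tgt H d = src H b"
    "b \<cdot> d = ident H (src H b)" "d \<cdot> b = ident H (tgt H b)"
    using assms(2) by (rule units_inverse)
  have M: "a \<in> Mor H" "b \<in> Mor H" "c \<in> Mor H" "d \<in> Mor H"
    using assms c d by (auto simp: units_Mor)
  have "(a \<cdot> b) \<cdot> (d \<cdot> c) = a \<cdot> ((b \<cdot> d) \<cdot> c)"
    using M assms(3) c(1-3) d(1-3) by (simp add: comp_assoc comp_closed src_comp tgt_comp)
  also have "\<dots> = ident H (src H a)"
    using M assms(3) c d by (metis ident_left)
  finally have 1: "(a \<cdot> b) \<cdot> (d \<cdot> c) = ident H (src H (a \<cdot> b))"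
    using M assms(3) by (simp add: src_comp)
  have "(d \<cdot> c) \<cdot> (a \<cdot> b) = d \<cdot> ((c \<cdot> a) \<cdot> b)"
    using M assms(3) c(1-3) d(1-3) by (simp add: comp_assoc comp_closed src_comp tgt_comp)
  also have "\<dots> = ident H (tgt H b)"
    using M assms(3) c d by (metis ident_left)
  finally have 2: "(d \<cdot> c) \<cdot> (a \<cdot> b) = ident H (tgt H (a \<cdot> b))"
    using M assms(3) by (simp add: tgt_comp)
  show ?thesis
    unfolding units_def using M assms(3) c d 1 2
    by (auto simp: comp_closed src_comp tgt_comp intro!: bexI[of _ "d \<cdot> c"])
qed

lemma associated_compI:
  assumes "a \<in> Mor H" "\<epsilon> \<in> units H" "\<eta> \<in> units H" "tgt H \<epsilon> = src H a" "tgt H a = src H \<eta>"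
  shows "associated H a (\<epsilon> \<cdot> a \<cdot> \<eta>)"
  unfolding associated_def using assms
  by (auto simp: comp_closed src_comp tgt_comp units_Mor)

lemma associated_refl:
  assumes "a \<in> Mor H"
  shows "associated H a a"
proof -
  have "associated H a (ident H (src H a) \<cdot> a \<cdot> ident H (tgt H a))"
    using assms
    by (intro associated_compI) (auto simp: ident_units src_closed tgt_closed src_ident tgt_ident)
  then show ?thesis
    using assms by (simp add: ident_left ident_right)
qed

lemma associated_sym:
  assumes "associated H a b"
  shows "associated H b a"
proof -
  obtain \<epsilon> \<eta> where e: "a \<in> Mor H" "b \<in> Mor H" "\<epsilon> \<in> units H" "\<eta> \<in> units H"
    "tgt H \<epsilon> = src H a" "tgt H a = src H \<eta>" "b = \<epsilon> \<cdot> a \<cdot> \<eta>"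
    using assms unfolding associated_def by auto
  obtain c where c: "c \<in> units H" "src H c = tgt H \<epsilon>" "tgt H c = src H \<epsilon>"
    "c \<cdot> \<epsilon> = ident H (tgt H \<epsilon>)"
    using e(3) by (rule units_inverse)
  obtain d where d: "d \<in> units H" "src H d = tgt H \<eta>" "tgt H d = src H \<eta>"
    "\<eta> \<cdot> d = ident H (src H \<eta>)"
    using e(4) by (rule units_inverse)
  have M: "\<epsilon> \<in> Mor H" "\<eta> \<in> Mor H" "c \<in> Mor H" "d \<in> Mor H"
    using e c d by (auto simp: units_Mor)
  have "c \<cdot> b \<cdot> d = ((c \<cdot> \<epsilon>) \<cdot> a) \<cdot> (\<eta> \<cdot> d)"
    using e c(1-3) d(1-3) M by (simp add: comp_assoc comp_closed src_comp tgt_comp)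
  also have "\<dots> = a"
    using e c d by (metis ident_left ident_right)
  finally have "c \<cdot> b \<cdot> d = a" .
  moreover have "associated H b (c \<cdot> b \<cdot> d)"
    using e c d M by (intro associated_compI) (auto simp: comp_closed src_comp tgt_comp)
  ultimately show ?thesis
    by simp
qed

lemma associated_trans:
  assumes "associated H a b" "associated H b c"
  shows "associated H a c"
proof -
  obtain \<epsilon> \<eta> where e: "a \<in> Mor H" "b \<in> Mor H" "\<epsilon> \<in> units H" "\<eta> \<in> units H"
    "tgt H \<epsilon> = src H a" "tgt H a = src H \<eta>" "b = \<epsilon> \<cdot> a \<cdot> \<eta>"
    using assms unfolding associated_def by auto
  obtain \<epsilon>' \<eta>' where e': "c \<in> Mor H" "\<epsilon>' \<in> units H" "\<eta>' \<in> units H"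
    "tgt H \<epsilon>' = src H b" "tgt H b = src H \<eta>'" "c = \<epsilon>' \<cdot> b \<cdot> \<eta>'"
    using assms unfolding associated_def by auto
  have M: "\<epsilon> \<in> Mor H" "\<eta> \<in> Mor H" "\<epsilon>' \<in> Mor H" "\<eta>' \<in> Mor H"
    using e e' by (auto simp: units_Mor)
  have b: "src H b = src H \<epsilon>" "tgt H b = tgt H \<eta>"
    using e M by (auto simp: comp_closed src_comp tgt_comp)
  have "c = (\<epsilon>' \<cdot> \<epsilon>) \<cdot> a \<cdot> (\<eta> \<cdot> \<eta>')"
    using e e' b M by (simp add: comp_assoc comp_closed src_comp tgt_comp)
  then show ?thesis
    using associated_compI[of a "\<epsilon>' \<cdot> \<epsilon>" "\<eta> \<cdot> \<eta>'"] e e' b M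
    by (simp add: units_comp src_comp tgt_comp)
qed

text \<open>Symmetry and transitivity give one direction; reflexivity at \<open>b\<close> gives the
  other.\<close>

lemma associated_iff_class:
  assumes "a \<in> Mor H"
  shows "associated H a b \<longleftrightarrow> b \<in> Mor H \<and> assoc_class H a = assoc_class H b"
proof
  assume ab: "associated H a b"
  then have "associated H a c \<longleftrightarrow> associated H b c" for c
    using associated_sym associated_trans by blast
  moreover have "b \<in> Mor H"
    using ab by (simp add: associated_def)
  ultimately show "b \<in> Mor H \<and> assoc_class H a = assoc_class H b"
    by (simp add: assoc_class_def)
next
  assume "b \<in> Mor H \<and> assoc_class H a = assoc_class H b"
  then show "associated H a b"
    using associated_refl[of b] by (auto simp: assoc_class_def)
qed

text \<open>If \<open>d\<close> inverts \<open>\<eta>\<close>, a decomposition of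
  \<open>u \<cdot> \<eta>\<close> into \<open>a\<close> and \<open>b\<close> yields one of
  \<open>u\<close> into \<open>a\<close> and \<open>b \<cdot> d\<close>, and \<open>b\<close> is a
  unit as soon as \<open>b \<cdot> d\<close> is. Needed later, when an atom absorbs the unit that
  follows it.\<close>

lemma atoms_comp_unit:
  assumes "u \<in> atoms H" "\<eta> \<in> units H" "tgt H u = src H \<eta>"
  shows "u \<cdot> \<eta> \<in> atoms H"
proof -
  obtain d where d: "d \<in> units H" "src H d = tgt H \<eta>" "tgt H d = src H \<eta>"
    "\<eta> \<cdot> d = ident H (src H \<eta>)" "d \<cdot> \<eta> = ident H (tgt H \<eta>)"
    using assms(2) by (rule units_inverse)
  have M: "u \<in> Mor H" "\<eta> \<in> Mor H" "d \<in> Mor H"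
    using assms d by (auto simp: units_Mor atoms_Mor)
  have canc: "u \<cdot> \<eta> \<cdot> d = u"
    using M assms(3) d by (metis comp_assoc ident_right)
  have "u \<cdot> \<eta> \<notin> units H"
    using units_comp[of "u \<cdot> \<eta>" d] canc assms d M by (auto simp: tgt_comp atoms_def)
  moreover have "a \<in> units H \<or> b \<in> units H"
    if ab: "a \<in> Mor H" "b \<in> Mor H" "tgt H a = src H b" "u \<cdot> \<eta> = a \<cdot> b" for a b
  proof -
    have t: "tgt H b = tgt H \<eta>"
      using ab M assms(3) by (metis tgt_comp)
    have "u = a \<cdot> (b \<cdot> d)"
      using ab M canc d t by (metis comp_assoc)
    then have "a \<in> units H \<or> b \<cdot> d \<in> units H"
      using assms(1) ab t d M unfolding atoms_def by (auto simp: comp_closed src_comp)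
    moreover have "b \<cdot> d \<cdot> \<eta> = b"
      using ab t d M by (metis comp_assoc ident_right)
    ultimately show ?thesis
      using units_comp[of "b \<cdot> d" \<eta>] assms(2) ab t d M by (auto simp: tgt_comp)
  qed
  ultimately show ?thesis
    unfolding atoms_def using M assms(3) by (auto simp: comp_closed)
qed

lemma assoc_class_comp_unit:
  assumes "u \<in> Mor H" "\<eta> \<in> units H" "tgt H u = src H \<eta>"
  shows "assoc_class H (u \<cdot> \<eta>) = assoc_class H u"
proof -
  have "associated H u (ident H (src H u) \<cdot> u \<cdot> \<eta>)"
    using assms by (intro associated_compI) (auto simp: ident_units src_closed tgt_ident)
  then show ?thesis
    using assms by (simp add: ident_left associated_iff_class)
qed

section \<open>Matchings as common submultisets\<close>

lemma matching_iff_class: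
  assumes "set us \<subseteq> Mor H" "set vs \<subseteq> Mor H"
  shows "matching H us vs I \<sigma> \<longleftrightarrow>
    I \<subseteq> {..<length us} \<and> inj_on \<sigma> I \<and> \<sigma> ` I \<subseteq> {..<length vs} \<and>
    (\<forall>i \<in> I. assoc_class H (us ! i) = assoc_class H (vs ! \<sigma> i))"
proof -
  have "us ! i \<in> Mor H" if "i < length us" for i
    using assms(1) that by auto
  moreover have "vs ! i \<in> Mor H" if "i < length vs" for i
    using assms(2) that by auto
  ultimately show ?thesis
    unfolding matching_def by (auto simp: associated_iff_class subset_eq)
qed

text \<open>Injectivity makes \<open>\<sigma>\<close> a reindexing of \<open>I\<close> by its image,
  and matched positions carry the same class.\<close>

lemma matching_image_mset:
  assumes "set us \<subseteq> Mor H" "set vs \<subseteq> Mor H" "matching H us vs I \<sigma>"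
  shows "image_mset (\<lambda>i. assoc_class H (us ! i)) (mset_set I)
      = image_mset (\<lambda>j. assoc_class H (vs ! j)) (mset_set (\<sigma> ` I))"
proof -
  have m: "I \<subseteq> {..<length us}" "inj_on \<sigma> I"
    "\<forall>i \<in> I. assoc_class H (us ! i) = assoc_class H (vs ! \<sigma> i)"
    using assms(3) unfolding matching_iff_class[OF assms(1,2)] by simp_all
  then have "finite I"
    using finite_subset by blast
  have "image_mset (\<lambda>j. assoc_class H (vs ! j)) (mset_set (\<sigma> ` I))
      = image_mset (\<lambda>i. assoc_class H (vs ! \<sigma> i)) (mset_set I)"
    unfolding image_mset_mset_set[OF m(2), symmetric] by (simp add: multiset.map_comp o_def)
  then show ?thesis
    using m(3) \<open>finite I\<close> by (auto intro!: image_mset_cong)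
qed

lemma matching_subset_factor_mset:
  assumes "set us \<subseteq> Mor H" "set vs \<subseteq> Mor H" "matching H us vs I \<sigma>"
  shows "image_mset (\<lambda>i. assoc_class H (us ! i)) (mset_set I)
      \<subseteq># factor_mset H us \<inter># factor_mset H vs"
proof -
  have "I \<subseteq> {..<length us}" "\<sigma> ` I \<subseteq> {..<length vs}"
    using assms(3) by (auto simp: matching_def)
  then show ?thesis
    using image_mset_subset_factor_mset[of I us H] image_mset_subset_factor_mset[of "\<sigma> ` I" vs H]
      matching_image_mset[OF assms] by simp
qed

lemma ex_matching:
  assumes "set us \<subseteq> Mor H" "set vs \<subseteq> Mor H"
    and "N \<subseteq># factor_mset H us" "N \<subseteq># factor_mset H vs"
  shows "\<exists>I \<sigma>. matching H us vs I \<sigma> \<and> image_mset (\<lambda>i. assoc_class H (us ! i)) (mset_set I) = N"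
  using assms(3,4)
proof (induction N)
  case empty
  show ?case
    by (auto simp: matching_def)
next
  case (add x N)
  have "N \<subseteq># factor_mset H us" "N \<subseteq># factor_mset H vs"
    using add.prems by (auto dest: mset_subset_eq_insertD subset_mset.less_imp_le)
  then obtain I \<sigma> where I: "matching H us vs I \<sigma>"
    and N: "image_mset (\<lambda>i. assoc_class H (us ! i)) (mset_set I) = N"
    using add.IH by blast
  have sub: "I \<subseteq> {..<length us}" "\<sigma> ` I \<subseteq> {..<length vs}"
    using I by (auto simp: matching_def)
  obtain i where i: "i < length us" "i \<notin> I" "assoc_class H (us ! i) = x"
    using ex_unused_index[of I us x H] sub N add.prems(1) by blast
  \<comment> \<open>The positions already used in \<open>vs\<close> carry the same multiset
    \<open>N\<close>, so a free position can be found there as well.\<close>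
  have N': "image_mset (\<lambda>j. assoc_class H (vs ! j)) (mset_set (\<sigma> ` I)) = N"
    using matching_image_mset[OF assms(1,2) I] N by simp
  obtain j where j: "j < length vs" "j \<notin> \<sigma> ` I" "assoc_class H (vs ! j) = x"
    using ex_unused_index[of "\<sigma> ` I" vs x H] sub N' add.prems(2) by blast
  have "matching H us vs (insert i I) (\<sigma>(i := j))"
    using I i j unfolding matching_iff_class[OF assms(1,2)]
    by (auto simp: inj_on_def)
  moreover have "finite I"
    using sub(1) finite_subset by blast
  ultimately show ?case
    using i N by (intro exI[of _ "insert i I"] exI[of _ "\<sigma>(i := j)"]) (simp del: fun_upd_apply)
qed

text \<open>A matching that realizes the whole of \<open>factor_mset H us\<close> has as many
  positions as \<open>us\<close>, so it leaves none out.\<close>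

lemma full_matching_iff:
  assumes "set us \<subseteq> Mor H" "set vs \<subseteq> Mor H"
  shows "(\<exists>\<sigma>. matching H us vs {..<length us} \<sigma>) \<longleftrightarrow> factor_mset H us \<subseteq># factor_mset H vs"
proof
  assume "\<exists>\<sigma>. matching H us vs {..<length us} \<sigma>"
  then show "factor_mset H us \<subseteq># factor_mset H vs"
    using matching_subset_factor_mset[OF assms] by (fastforce simp: factor_mset_nth[of H us])
next
  assume "factor_mset H us \<subseteq># factor_mset H vs"
  then obtain I \<sigma> where I: "matching H us vs I \<sigma>"
    and N: "image_mset (\<lambda>i. assoc_class H (us ! i)) (mset_set I) = factor_mset H us"
    using ex_matching[OF assms] by blast
  have "card I = length us"
    using arg_cong[OF N, of size] by simp
  moreover have "I \<subseteq> {..<length us}"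
    using I by (simp add: matching_def)
  ultimately have "I = {..<length us}"
    by (simp add: card_subset_eq)
  with I show "\<exists>\<sigma>. matching H us vs {..<length us} \<sigma>"
    by blast
qed

text \<open>The largest matching has the size of the multiset intersection: every matching yields a
  common submultiset, and the intersection itself is realized by a matching.\<close>

lemma tuple_dist_eq:
  assumes "set us \<subseteq> Mor H" "set vs \<subseteq> Mor H"
  shows "tuple_dist H (\<epsilon>, us) (\<eta>, vs)
    = max (length us) (length vs) - size (factor_mset H us \<inter># factor_mset H vs)"
proof -
  have "Max {card I | I. \<exists>\<sigma>. matching H us vs I \<sigma>} = size (factor_mset H us \<inter># factor_mset H vs)"
  proof (rule Max_eqI)
    have "{card I | I. \<exists>\<sigma>. matching H us vs I \<sigma>} \<subseteq> card ` Pow {..<length us}"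
      by (auto simp: matching_def)
    then show "finite {card I | I. \<exists>\<sigma>. matching H us vs I \<sigma>}"
      by (rule finite_subset) simp
  next
    fix n assume "n \<in> {card I | I. \<exists>\<sigma>. matching H us vs I \<sigma>}"
    then show "n \<le> size (factor_mset H us \<inter># factor_mset H vs)"
      using size_mset_mono[OF matching_subset_factor_mset[OF assms]] by auto
  next
    obtain I \<sigma> where "matching H us vs I \<sigma>"
      and N: "image_mset (\<lambda>i. assoc_class H (us ! i)) (mset_set I)
        = factor_mset H us \<inter># factor_mset H vs"
      using ex_matching[OF assms, of "factor_mset H us \<inter># factor_mset H vs"] by auto
    moreover have "card I = size (factor_mset H us \<inter># factor_mset H vs)"
      using arg_cong[OF N, of size] by simp
    ultimately show "size (factor_mset H us \<inter># factor_mset H vs)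
        \<in> {card I | I. \<exists>\<sigma>. matching H us vs I \<sigma>}"
      by force
  qed
  then show ?thesis
    by (simp add: tuple_dist_def)
qed

lemma tuple_dist_eq_0_iff:
  assumes "set us \<subseteq> Mor H" "set vs \<subseteq> Mor H"
  shows "tuple_dist H (\<epsilon>, us) (\<eta>, vs) = 0 \<longleftrightarrow> factor_mset H us = factor_mset H vs"
  using max_size_diff_inter_eq_0_iff[of "factor_mset H us" "factor_mset H vs"]
  by (simp add: tuple_dist_eq[OF assms])


section \<open>Permutable factorizations as multisets\<close>

lemma tuples_Mor: "(\<epsilon>, us) \<in> tuples H \<Longrightarrow> set us \<subseteq> Mor H"
  by (auto simp: tuples_def atoms_Mor)

lemma tuple_rel_iff:
  "((\<epsilon>, us), (\<eta>, vs)) \<in> tuple_rel H \<longleftrightarrow> (\<epsilon>, us) \<in> tuples H \<and> (\<eta>, vs) \<in> tuples H \<and>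
     prod_from H \<epsilon> us = prod_from H \<eta> vs \<and> factor_mset H us = factor_mset H vs"
proof (cases "(\<epsilon>, us) \<in> tuples H \<and> (\<eta>, vs) \<in> tuples H")
  case True
  then show ?thesis
    using tuple_dist_eq_0_iff[of us vs \<epsilon> \<eta>] tuples_Mor[of \<epsilon> us] tuples_Mor[of \<eta> vs]
    by (simp add: tuple_rel_def tuple_prod_def)
qed (auto simp: tuple_rel_def)

text \<open>Fibre of the map from tuples to product and multiset. The nonempty fibres are exactly
  the classes of \<open>tuple_rel H\<close>.\<close>

definition fact_class :: "'m \<Rightarrow> 'm set multiset \<Rightarrow> 'm tuple set" where
  "fact_class a M =
     {(\<epsilon>, us). (\<epsilon>, us) \<in> tuples H \<and> prod_from H \<epsilon> us = a \<and> factor_mset H us = M}"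

lemma tuple_rel_Image:
  "(\<epsilon>, us) \<in> tuples H \<Longrightarrow>
     tuple_rel H `` {(\<epsilon>, us)} = fact_class (prod_from H \<epsilon> us) (factor_mset H us)"
  by (auto simp: fact_class_def tuple_rel_iff)

lemma Zp_eq: "Zp H = {fact_class a M | a M. M \<in> factor_msets H a}"
proof -
  have "Zp H = {tuple_rel H `` {(\<epsilon>, us)} | \<epsilon> us. (\<epsilon>, us) \<in> tuples H}"
    by (auto simp: Zp_def quotient_def)
  also have "\<dots> = {fact_class (prod_from H \<epsilon> us) (factor_mset H us) | \<epsilon> us. (\<epsilon>, us) \<in> tuples H}"
    using tuple_rel_Image by blast
  also have "\<dots> = {fact_class a M | a M. M \<in> factor_msets H a}"
    unfolding factor_msets_def by blast
  finally show ?thesis .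
qed

lemma factor_msetsE:
  assumes "M \<in> factor_msets H a"
  obtains \<epsilon> us where "(\<epsilon>, us) \<in> tuples H" "prod_from H \<epsilon> us = a" "factor_mset H us = M"
  using assms by (auto simp: factor_msets_def)

lemma factor_msets_iff: "M \<in> factor_msets H a \<longleftrightarrow> fact_class a M \<noteq> {}"
  by (auto simp: factor_msets_def fact_class_def)

text \<open>All tuples in a fibre have the same product, so it does not matter which representative
  \<open>Zp_of\<close> tests.\<close>

lemma Zp_of_eq: "Zp_of H a = fact_class a ` factor_msets H a"
proof -
  have "Zp_of H a = {fact_class b M | b M. M \<in> factor_msets H b \<and> b = a}"
    unfolding Zp_of_def Zp_eq
    by (auto simp: fact_class_def tuple_prod_def factor_msets_def) blast+
  then show ?thesis
    by blast
qed

lemma fact_class_eq_iff: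
  "M \<in> factor_msets H a \<Longrightarrow> fact_class a M = fact_class a N \<longleftrightarrow> M = N"
  by (auto simp: factor_msets_iff) (auto simp: fact_class_def)

text \<open>Every pair of representatives gives the same answer by \<open>full_matching_iff\<close>,
  and the two membership assumptions ensure that representatives exist.\<close>

lemma fact_dvd_iff:
  assumes "M \<in> factor_msets H a" "N \<in> factor_msets H b"
  shows "fact_dvd H (fact_class a M) (fact_class b N) \<longleftrightarrow> M \<subseteq># N"
proof -
  have "(\<exists>\<sigma>. matching H (snd f) (snd g) {..<length (snd f)} \<sigma>) \<longleftrightarrow> M \<subseteq># N"
    if "f \<in> fact_class a M" "g \<in> fact_class b N" for f g
    using that full_matching_iff[of "snd f" "snd g"] tuples_Mor
    by (auto simp: fact_class_def)
  moreover have "fact_class a M \<noteq> {}" "fact_class b N \<noteq> {}"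
    using assms by (simp_all add: factor_msets_iff)
  ultimately show ?thesis
    unfolding fact_dvd_def by blast
qed

text \<open>The distance of two tuples depends only on their multisets, so the definite description
  in \<open>dp\<close> picks out a unique value.\<close>

lemma dp_eq_0_iff:
  assumes "M \<in> factor_msets H a" "N \<in> factor_msets H b"
  shows "dp H (fact_class a M) (fact_class b N) = 0 \<longleftrightarrow> M = N"
proof -
  have d: "tuple_dist H f g = max (size M) (size N) - size (M \<inter># N)"
    if "f \<in> fact_class a M" "g \<in> fact_class b N" for f g
    using that tuple_dist_eq[of "snd f" "snd g" "fst f" "fst g"] tuples_Mor
    by (auto simp: fact_class_def)
  obtain f g where "f \<in> fact_class a M" "g \<in> fact_class b N"
    using assms by (auto simp: factor_msets_iff)
  then have "dp H (fact_class a M) (fact_class b N) = max (size M) (size N) - size (M \<inter># N)"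
    unfolding dp_def by (intro the_equality) (metis d)+
  then show ?thesis
    using max_size_diff_inter_eq_0_iff by metis
qed

section \<open>Vanishing of the tame degree\<close>

lemma tame_at_eq_0_iff:
  assumes "M \<in> factor_msets H b"
  shows "tame_at H a (fact_class b M) = 0 \<longleftrightarrow>
    ((\<exists>N \<in> factor_msets H a. M \<subseteq># N) \<longrightarrow> (\<forall>N \<in> factor_msets H a. M \<subseteq># N))"
proof -
  define P where "P = (\<lambda>N::enat. (\<exists>z0 \<in> Zp_of H a. fact_dvd H (fact_class b M) z0) \<longrightarrow>
     (\<forall>z \<in> Zp_of H a. \<exists>z' \<in> Zp_of H a. fact_dvd H (fact_class b M) z' \<and> enat (dp H z z') \<le> N))"
  \<comment> \<open>With no bound on the distance, \<open>z0\<close> itself serves as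
    \<open>z'\<close>, so the least value is attained.\<close>
  have "P \<infinity>"
    by (auto simp: P_def)
  then have "P (LEAST N. P N)"
    by (rule LeastI)
  then have "(LEAST N. P N) = 0 \<longleftrightarrow> P 0"
    using Least_le[of P 0] by auto
  \<comment> \<open>Distance 0 forces \<open>z'\<close> to have the multiset of \<open>z\<close>, so
    \<open>z\<close> itself must be divisible.\<close>
  also have "P 0 \<longleftrightarrow> ((\<exists>N \<in> factor_msets H a. M \<subseteq># N) \<longrightarrow>
      (\<forall>N \<in> factor_msets H a. \<exists>N' \<in> factor_msets H a. M \<subseteq># N' \<and> N = N'))"
    by (simp add: P_def Zp_of_eq fact_dvd_iff[OF assms] dp_eq_0_iff enat_0_iff)
  finally show ?thesis
    unfolding tame_at_def P_def[symmetric] by auto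
qed

lemma tame_eq_0_iff: "tame H A Z = 0 \<longleftrightarrow> (\<forall>a \<in> A. \<forall>z \<in> Z. tame_at H a z = 0)"
proof -
  \<comment> \<open>A supremum is \<open>bot\<close> iff all members are, and \<open>bot\<close> in
    \<open>enat\<close> is 0.\<close>
  have "tame H A Z = bot \<longleftrightarrow> (\<forall>a \<in> A. \<forall>z \<in> Z. tame_at H a z = bot)"
    unfolding tame_def Sup_bot_conv by blast
  then show ?thesis
    by (simp add: bot_enat_def)
qed

section \<open>Factorizations of products and of associated elements\<close>

lemma prod_from_comp:
  assumes "a \<in> Mor H" "b \<in> Mor H" "tgt H a = src H b" "set us \<subseteq> Mor H" "path H (tgt H b) us"
  shows "prod_from H (a \<cdot> b) us = a \<cdot> prod_from H b us"
  using assms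
proof (induction us arbitrary: b)
  case Nil
  then show ?case
    by (simp add: prod_from_def)
next
  case (Cons u us)
  then have "prod_from H (a \<cdot> (b \<cdot> u)) us = a \<cdot> prod_from H (b \<cdot> u) us"
    by (intro Cons.IH) (auto simp: comp_closed src_comp tgt_comp)
  with Cons.prems show ?case
    by (simp add: prod_from_def comp_assoc)
qed

text \<open>The last conjunct locates the end of the path: \<open>path\<close> only tests
  composability, so the end object is described by which continuations are allowed.\<close>

lemma prod_from_closed:
  assumes "a \<in> Mor H" "set us \<subseteq> Mor H" "path H (tgt H a) us"
  shows "prod_from H a us \<in> Mor H \<and> src H (prod_from H a us) = src H a
    \<and> (\<forall>vs. path H (tgt H a) (us @ vs) \<longleftrightarrow> path H (tgt H (prod_from H a us)) vs)"
  using assms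
proof (induction us arbitrary: a)
  case Nil
  then show ?case
    by (simp add: prod_from_def)
next
  case (Cons u us)
  then show ?case
    using Cons.IH[of "a \<cdot> u"] by (auto simp: prod_from_def comp_closed src_comp tgt_comp)
qed

lemma factor_msets_add:
  assumes "M \<in> factor_msets H a" "N \<in> factor_msets H b" "tgt H a = src H b"
  shows "M + N \<in> factor_msets H (a \<cdot> b)"
proof -
  obtain \<epsilon> us where f: "(\<epsilon>, us) \<in> tuples H" "prod_from H \<epsilon> us = a" "factor_mset H us = M"
    using assms(1) by (rule factor_msetsE)
  obtain \<eta> vs where g: "(\<eta>, vs) \<in> tuples H" "prod_from H \<eta> vs = b" "factor_mset H vs = N"
    using assms(2) by (rule factor_msetsE)
  have \<epsilon>: "\<epsilon> \<in> units H" "\<epsilon> \<in> Mor H" "set us \<subseteq> atoms H" "set us \<subseteq> Mor H" "path H (tgt H \<epsilon>) us"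
    using f tuples_Mor by (auto simp: tuples_def units_Mor)
  have \<eta>: "\<eta> \<in> units H" "\<eta> \<in> Mor H" "set vs \<subseteq> atoms H" "set vs \<subseteq> Mor H" "path H (tgt H \<eta>) vs"
    using g tuples_Mor by (auto simp: tuples_def units_Mor)
  have a: "a \<in> Mor H" "src H \<eta> = tgt H a"
    using prod_from_closed[OF \<epsilon>(2,4,5)] prod_from_closed[OF \<eta>(2,4,5)] f(2) g(2) assms(3) by auto
  \<comment> \<open>Shifts the problem to \<open>a \<cdot> \<eta>\<close>: once it is written as a
    unit followed by atoms, appending \<open>vs\<close> gives a tuple with product
    \<open>a \<cdot> b\<close>.\<close>
  have ab: "prod_from H (a \<cdot> \<eta>) vs = a \<cdot> b"
    using prod_from_comp[of a \<eta> vs] a \<eta> g(2) by simp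
  \<comment> \<open>The unit in the middle is absorbed by the last atom of the first factorization, if any.\<close>
  show ?thesis
  proof (cases us rule: rev_cases)
    case Nil
    then have "a = \<epsilon>"
      using f(2) by (simp add: prod_from_def)
    then have "(\<epsilon> \<cdot> \<eta>, vs) \<in> tuples H"
      using \<epsilon> \<eta> a by (auto simp: tuples_def units_comp tgt_comp)
    with ab \<open>a = \<epsilon>\<close> Nil f(3) g(3) show ?thesis
      unfolding factor_msets_def by fastforce
  next
    case (snoc ws w)
    have w: "w \<in> atoms H" "w \<in> Mor H" "set ws \<subseteq> atoms H" "set ws \<subseteq> Mor H"
      using \<epsilon> snoc by auto
    have "path H (tgt H \<epsilon>) ws"
      using \<epsilon>(5) unfolding snoc by (induction ws arbitrary: \<epsilon>) auto
    note ws = prod_from_closed[OF \<epsilon>(2) w(4) this]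
    let ?p = "prod_from H \<epsilon> ws"
    have p: "?p \<in> Mor H" "tgt H ?p = src H w"
      using ws \<epsilon>(5) snoc by auto
    have "a = ?p \<cdot> w"
      using f(2) snoc by (simp add: prod_from_def)
    then have w\<eta>: "tgt H w = src H \<eta>"
      using a p w by (simp add: tgt_comp)
    have "path H (tgt H \<epsilon>) (ws @ (w \<cdot> \<eta>) # vs)"
      using ws p w \<eta> w\<eta> by (simp add: src_comp tgt_comp)
    then have "(\<epsilon>, ws @ (w \<cdot> \<eta>) # vs) \<in> tuples H"
      using \<epsilon> \<eta> w w\<eta> by (auto simp: tuples_def atoms_comp_unit)
    moreover have "prod_from H \<epsilon> (ws @ (w \<cdot> \<eta>) # vs) = prod_from H (?p \<cdot> (w \<cdot> \<eta>)) vs"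
      by (simp add: prod_from_def)
    moreover have "?p \<cdot> (w \<cdot> \<eta>) = a \<cdot> \<eta>"
      using \<open>a = ?p \<cdot> w\<close> p w \<eta> w\<eta> by (simp add: comp_assoc)
    \<comment> \<open>Only \<open>w\<close> has changed, and \<open>w \<cdot> \<eta>\<close> stays
      in its class.\<close>
    moreover have "factor_mset H (ws @ (w \<cdot> \<eta>) # vs) = M + N"
      using f(3) g(3) snoc w \<eta> w\<eta> by (auto simp: assoc_class_comp_unit)
    ultimately show ?thesis
      using ab unfolding factor_msets_def by (metis (mono_tags, lifting) mem_Collect_eq)
  qed
qed

lemma factor_msets_unit: "\<epsilon> \<in> units H \<Longrightarrow> {#} \<in> factor_msets H \<epsilon>"
  unfolding factor_msets_def
  by (auto simp: tuples_def prod_from_def intro!: exI[of _ \<epsilon>] exI[of _ "[]"])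

text \<open>Units have the empty multiset, so multiplying by them on either side adds
  nothing.\<close>

lemma factor_msets_associated:
  assumes "M \<in> factor_msets H a" "associated H a b"
  shows "M \<in> factor_msets H b"
proof -
  obtain \<epsilon> \<eta> where e: "a \<in> Mor H" "\<epsilon> \<in> units H" "\<eta> \<in> units H"
    "tgt H \<epsilon> = src H a" "tgt H a = src H \<eta>" "b = \<epsilon> \<cdot> a \<cdot> \<eta>"
    using assms unfolding associated_def by auto
  have "M \<in> factor_msets H (\<epsilon> \<cdot> a)"
    using factor_msets_add[OF factor_msets_unit assms(1)] e by simp
  from factor_msets_add[OF this factor_msets_unit] show ?thesis
    using e by (simp add: tgt_comp units_Mor)
qed

lemma tuples_ident:
  assumes "e \<in> Ob H" "set us \<subseteq> atoms H" "path H e us"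
  shows "(ident H e, us) \<in> tuples H"
  using assms by (simp add: tuples_def ident_units tgt_ident)

lemma factor_msets_is_prod:
  assumes "set us \<subseteq> atoms H" "is_prod H us a"
  shows "factor_mset H us \<in> factor_msets H a"
  using assms tuples_ident unfolding is_prod_def factor_msets_def by blast

text \<open>Units have the empty factorization; non-units are covered by atomicity.\<close>

lemma factor_msets_nonempty:
  assumes "atomic H" "a \<in> Mor H"
  shows "factor_msets H a \<noteq> {}"
  using assms factor_msets_unit factor_msets_is_prod unfolding atomic_def by blast

lemma atom_fact_eq:
  assumes "u \<in> atoms H"
  shows "{#assoc_class H u#} \<in> factor_msets H u"
    and "atom_fact H u = fact_class u {#assoc_class H u#}"
proof -
  have t: "(ident H (src H u), [u]) \<in> tuples H"
    using assms by (intro tuples_ident) (auto simp: src_closed atoms_Mor)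
  have p: "prod_from H (ident H (src H u)) [u] = u"
    using assms by (simp add: prod_from_def ident_left atoms_Mor)
  show "{#assoc_class H u#} \<in> factor_msets H u"
    unfolding factor_msets_def using t p by force
  show "atom_fact H u = fact_class u {#assoc_class H u#}"
    using tuple_rel_Image[OF t] p by (simp add: atom_fact_def)
qed

section \<open>Divisibility, factoriality and multiplicities in terms of multisets\<close>

lemma perm_dvd_iff:
  "perm_dvd H a b \<longleftrightarrow> (\<exists>M \<in> factor_msets H a. \<exists>N \<in> factor_msets H b. M \<subseteq># N)"
  by (auto simp: perm_dvd_def Zp_of_eq fact_dvd_iff)

text \<open>\<open>fact_class a\<close> is injective on \<open>factor_msets H a\<close>, and
  atomicity supplies existence, so cardinality 1 amounts to uniqueness.\<close>

lemma permutably_factorial_iff: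
  assumes "atomic H"
  shows "permutably_factorial H \<longleftrightarrow>
    (\<forall>a \<in> Mor H. \<forall>M \<in> factor_msets H a. \<forall>N \<in> factor_msets H a. M = N)"
proof -
  have "card (Zp_of H a) = 1 \<longleftrightarrow> (\<forall>M \<in> factor_msets H a. \<forall>N \<in> factor_msets H a. M = N)"
    if "a \<in> Mor H" for a
  proof -
    have "inj_on (fact_class a) (factor_msets H a)"
      by (auto simp: inj_on_def fact_class_eq_iff)
    then have "card (Zp_of H a) = card (factor_msets H a)"
      by (simp add: Zp_of_eq card_image)
    then show ?thesis
      using factor_msets_nonempty[OF assms that] by (auto simp: card_1_singleton_iff)
  qed
  then show ?thesis
    by (simp add: permutably_factorial_def)
qed

lemma card_associated_eq_count:
  assumes "set us \<subseteq> Mor H" "q \<in> Mor H"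
  shows "card {i. i < length us \<and> associated H (us ! i) q}
    = count (factor_mset H us) (assoc_class H q)"
proof -
  have "{i. i < length us \<and> associated H (us ! i) q}
      = {i \<in> {..<length us}. assoc_class H (us ! i) = assoc_class H q}"
    using assms by (auto simp: associated_iff_class subset_eq)
  then show ?thesis
    by (simp add: factor_mset_nth count_image_mset' eq_commute)
qed

text \<open>\<open>V_set\<close> admits products of atoms up to association, whereas a tuple has a
  leading unit and the exact product; the two descriptions differ by units only.\<close>

lemma V_set_eq:
  assumes "q \<in> Mor H"
  shows "V_set H q a = (\<lambda>M. count M (assoc_class H q)) ` factor_msets H a"
proof (intro equalityI subsetI)
  fix n assume "n \<in> V_set H q a"
  then obtain us p where us: "set us \<subseteq> atoms H" "is_prod H us p" "associated H a p"
    "n = card {i. i < length us \<and> associated H (us ! i) q}"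
    by (auto simp: V_set_def)
  then have "factor_mset H us \<in> factor_msets H a"
    by (metis factor_msets_is_prod factor_msets_associated associated_sym)
  moreover have "set us \<subseteq> Mor H"
    using us(1) by (auto simp: atoms_Mor)
  ultimately show "n \<in> (\<lambda>M. count M (assoc_class H q)) ` factor_msets H a"
    using us(4) assms by (simp add: card_associated_eq_count)
next
  fix n assume "n \<in> (\<lambda>M. count M (assoc_class H q)) ` factor_msets H a"
  then obtain M where M: "M \<in> factor_msets H a" "n = count M (assoc_class H q)"
    by blast
  obtain \<epsilon> us where f: "(\<epsilon>, us) \<in> tuples H" "prod_from H \<epsilon> us = a" "factor_mset H us = M"
    using M(1) by (rule factor_msetsE)
  have \<epsilon>: "\<epsilon> \<in> units H" "\<epsilon> \<in> Mor H" "set us \<subseteq> atoms H" "set us \<subseteq> Mor H" "path H (tgt H \<epsilon>) us"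
    using f tuples_Mor by (auto simp: tuples_def units_Mor)
  \<comment> \<open>The same atoms are multiplied with an identity in place of
    \<open>\<epsilon>\<close>, so that \<open>?p\<close> is a plain product and \<open>a\<close> is
    \<open>\<epsilon> \<cdot> ?p\<close>.\<close>
  let ?i = "ident H (tgt H \<epsilon>)"
  let ?p = "prod_from H ?i us"
  have i: "?i \<in> Mor H" "src H ?i = tgt H \<epsilon>" "tgt H ?i = tgt H \<epsilon>"
    using \<epsilon> by (simp_all add: tgt_closed ident_closed src_ident tgt_ident)
  have p: "?p \<in> Mor H" "src H ?p = tgt H \<epsilon>"
    using prod_from_closed[of ?i us] i \<epsilon> by auto
  have "a = \<epsilon> \<cdot> ?p"
    using prod_from_comp[of \<epsilon> ?i us] \<epsilon> i f(2) by (simp add: ident_right)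
  \<comment> \<open>\<open>associated\<close> asks for a unit on each side; the right one is an
    identity.\<close>
  then have "a = \<epsilon> \<cdot> ?p \<cdot> ident H (tgt H ?p)"
    using p \<epsilon> by (metis comp_closed ident_right tgt_comp)
  moreover have "associated H ?p (\<epsilon> \<cdot> ?p \<cdot> ident H (tgt H ?p))"
    using p \<epsilon> by (intro associated_compI) (auto simp: ident_units tgt_closed src_ident)
  ultimately have "associated H a ?p"
    using associated_sym by simp
  moreover have "is_prod H us ?p"
    using \<epsilon> by (auto simp: is_prod_def tgt_closed)
  ultimately show "n \<in> V_set H q a"
    unfolding V_set_def using \<epsilon> M f assms
    by (auto simp: card_associated_eq_count intro!: exI[of _ us])
qed

section \<open>The implications between the three conditions\<close>

lemma permutably_factorial_imp_tame:
  assumes "atomic H" "permutably_factorial H"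
  shows "tame H (Mor H) (Zp H) = 0"
proof -
  have "M = N" if "a \<in> Mor H" "M \<in> factor_msets H a" "N \<in> factor_msets H a" for a M N
    using assms that by (simp add: permutably_factorial_iff)
  then show ?thesis
    by (auto simp: tame_eq_0_iff Zp_eq tame_at_eq_0_iff) metis
qed

lemma permutably_factorial_imp_prime_like:
  assumes "atomic H" "permutably_factorial H" "almost_prime_like H q"
  shows "prime_like H q"
proof -
  have "card (V_set H q a) = 1" if a: "a \<in> Mor H" for a
  proof -
    obtain M where "M \<in> factor_msets H a"
      using factor_msets_nonempty[OF assms(1) a] by blast
    then have "factor_msets H a = {M}"
      using assms a by (auto simp: permutably_factorial_iff)
    moreover have "q \<in> Mor H"
      using assms(3) by (simp add: almost_prime_like_def)
    ultimately show ?thesis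
      by (simp add: V_set_eq)
  qed
  with assms(3) show ?thesis
    by (simp add: prime_like_def)
qed

lemma tame_imp_tame_degree:
  assumes "tame H (Mor H) (Zp H) = 0"
  shows "tame_degree H = 0"
  using assms atom_fact_eq unfolding tame_degree_def tame_eq_0_iff Zp_eq by blast

lemma tame_degree_imp_permutably_factorial:
  assumes "atomic H" "tame_degree H = 0"
    and pl: "\<And>q. almost_prime_like H q \<Longrightarrow> prime_like H q"
  shows "permutably_factorial H"
proof -
  \<comment> \<open>Tame degree 0 at the factorization \<open>[u]\<close>: an atom class in one
    multiset of \<open>a\<close> lies in all of them.\<close>
  have tame: "assoc_class H u \<in># N"
    if "a \<in> Mor H" "u \<in> atoms H" "M \<in> factor_msets H a" "assoc_class H u \<in># M"
      "N \<in> factor_msets H a" for a u M N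
  proof -
    have "tame_at H a (fact_class u {#assoc_class H u#}) = 0"
      using assms(2) that(1,2) by (auto simp: tame_degree_def tame_eq_0_iff atom_fact_eq)
    then show ?thesis
      using that by (simp add: tame_at_eq_0_iff atom_fact_eq) blast
  qed
  have perm_dvdI: "perm_dvd H u a"
    if "u \<in> atoms H" "M \<in> factor_msets H a" "assoc_class H u \<in># M" for u a M
    unfolding perm_dvd_iff using that atom_fact_eq(1)[of u]
    by (intro bexI[of _ "{#assoc_class H u#}"] bexI[of _ M]) simp_all
  have "almost_prime_like H u" if u: "u \<in> atoms H" for u
    unfolding almost_prime_like_def
  proof (intro conjI ballI impI)
    show "u \<in> Mor H" "u \<notin> units H"
      using u by (auto simp: atoms_def)
    fix a b assume a: "a \<in> Mor H" and b: "b \<in> Mor H"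
      and ab: "tgt H a = src H b \<and> perm_dvd H u (a \<cdot> b)"
    obtain L P where LP: "L \<in> factor_msets H u" "P \<in> factor_msets H (a \<cdot> b)" "L \<subseteq># P"
      using ab by (auto simp: perm_dvd_iff)
    \<comment> \<open>\<open>perm_dvd\<close> allows any factorization \<open>L\<close> of
      \<open>u\<close>; applying \<open>tame\<close> to the element \<open>u\<close> carries its
      class from \<open>[u]\<close> over to \<open>L\<close>.\<close>
    have "assoc_class H u \<in># L"
      using tame[OF atoms_Mor[OF u] u atom_fact_eq(1)[OF u]] LP(1) by simp
    then have P: "assoc_class H u \<in># P"
      using LP(3) by (rule mset_subset_eqD[rotated])
    obtain M N where MN: "M \<in> factor_msets H a" "N \<in> factor_msets H b"
      using factor_msets_nonempty[OF assms(1)] a b by blast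
    then have "M + N \<in> factor_msets H (a \<cdot> b)"
      using ab by (simp add: factor_msets_add)
    \<comment> \<open>\<open>P\<close> and \<open>M + N\<close> both belong to
      \<open>a \<cdot> b\<close>, so \<open>tame\<close> moves the class from one to the other;
      there it must lie in \<open>M\<close> or in \<open>N\<close>.\<close>
    then have "assoc_class H u \<in># M + N"
      using tame u P LP(2) a b ab by (meson comp_closed)
    then show "perm_dvd H u a \<or> perm_dvd H u b"
      using perm_dvdI u MN by auto
  qed
  then have prime: "prime_like H u" if "u \<in> atoms H" for u
    using pl that by blast
  have count_eq: "count M (assoc_class H u) = count N (assoc_class H u)"
    if "a \<in> Mor H" "u \<in> atoms H" "M \<in> factor_msets H a" "N \<in> factor_msets H a" for a u M N
  proof -
    have "card (V_set H u a) = 1"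
      using prime that(1,2) by (simp add: prime_like_def)
    then obtain n where "V_set H u a = {n}"
      by (rule card_1_singletonE)
    moreover have "count M (assoc_class H u) \<in> V_set H u a" "count N (assoc_class H u) \<in> V_set H u a"
      using that(2-4) by (simp_all add: V_set_eq atoms_Mor)
    ultimately show ?thesis
      by simp
  qed
  \<comment> \<open>Only classes of atoms occur, so \<open>count_eq\<close> controls all nonzero
    multiplicities.\<close>
  have classes: "\<exists>u \<in> atoms H. c = assoc_class H u" if "M \<in> factor_msets H a" "c \<in># M" for a M c
    using that by (auto simp: factor_msets_def factor_mset_def tuples_def) blast
  have "M = N"
    if "a \<in> Mor H" "M \<in> factor_msets H a" "N \<in> factor_msets H a" for a M N
  proof (rule multiset_eqI)
    fix c
    show "count M c = count N c"
    proof (cases "c \<in># M \<or> c \<in># N")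
      case True
      then show ?thesis
        using classes count_eq that by blast
    next
      case False
      then show ?thesis
        by (simp add: not_in_iff)
    qed
  qed
  then show ?thesis
    using assms(1) by (simp add: permutably_factorial_iff)
qed

end

theorem proposition5p21:
  fixes H :: "('o, 'm) cat"
  assumes "small_category H"
    and "cancellative H"
    and "atomic H"
  shows "(permutably_factorial H \<longleftrightarrow>
           tame_degree H = 0 \<and> (\<forall>q \<in> Mor H. almost_prime_like H q \<longrightarrow> prime_like H q))
       \<and> (permutably_factorial H \<longleftrightarrow>
           tame H (Mor H) (Zp H) = 0 \<and> (\<forall>q \<in> Mor H. almost_prime_like H q \<longrightarrow> prime_like H q))"
proof -
  interpret small_category H by fact
  \<comment> \<open>The implications run from (1) to (3), to (2), and back to (1). Unfolding
    \<open>almost_prime_like\<close> shows that such elements are morphisms, which reconciles the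
    bounded quantifier with the unbounded one in the last implication.\<close>
  show ?thesis
    using permutably_factorial_imp_tame permutably_factorial_imp_prime_like tame_imp_tame_degree
      tame_degree_imp_permutably_factorial \<open>atomic H\<close>
    by (meson almost_prime_like_def)
qed

end
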